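(* Let $S$ be a set, let $(I,C)$ be an axiom-set on $S$ and let $\delta:S\times S\to\mathcal P(S)$ be an arbitrary map. For $U,V\subseteq S$ put $U\circ V=\bigcup\{\delta(a,b)\mid a\in U,\ b\in V\}$. Let $(J,D)$ be the axiom-set obtained from $(I,C)$ by adding the axioms - $a\lhd c\circ b$, for all $a,b,c\in S$ with $a\in b\circ c$; - $a\lhd b\circ(c\circ d)$, for all $a,b,c,d\in S$ with $a\in(b\circ c)\circ d$; and let $(J',D')$ be the axiom-set obtained from $(J,D)$ by adding the axioms - $a\lhd D(b,j)\circ c$, for all $a,b,c\in S$ and $j\in J(b)$ with $a\in b\circ c$. Let $\lhd$ be the basic cover generated by $(J',D')$. Then $(S,\lhd,\circ)$ is a convergent cover in which $\lhd$ contains $\lhd_{I,C}$ (that is, $a\lhd_{I,C}U$ implies $a\lhd U$ for all $a\in S$, $U\subseteq S$) and $\circ$ extends $\delta$ (that is, $a\circ b=_{\mathcal A}\delta(a,b)$ for all $a,b\in S$). Moreover, if $(S,\lhd',\circ')$ is any convergent cover in which $\lhd'$ contains $\lhd_{I,C}$ and $\circ'$ extends $\delta$ (that is, $a\circ' b=_{\mathcal A'}\delta(a,b)$ for all $a,b\in S$), then $\lhd'$ contains $\lhd$, and $U\circ' V=_{\mathcal A'}U\circ V$ for all $U,V\subseteq S$.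
   Context: A basic cover on a set $S$ is a relation $\lhd$ between elements and subsets of $S$ such that (reflexivity) $a\in U$ implies $a\lhd U$, and (transitivity) $a\lhd U$ and $U\lhd V$ imply $a\lhd V$, where $U\lhd V$ means $b\lhd V$ for all $b\in U$. Put $\mathcal A U=\{a\in S\mid a\lhd U\}$ (and $\mathcal A'$ for $\lhd'$); $U=_{\mathcal A}V$ means $\mathcal A U=\mathcal A V$. $Sat(\mathcal A)=\{U\subseteq S\mid U=\mathcal A U\}$ is a suplattice with joins $\bigvee^{\mathcal A}_i\mathcal A U_i=\mathcal A(\bigcup_i U_i)$. Elements are identified with singletons; for a binary operation $\circ$ on $\mathcal P(S)$ write $a\circ b=\{a\}\circ\{b\}$, $U\circ c=U\circ\{c\}$, $b\circ V=\{b\}\circ V$. An axiom-set $(I,C)$ on $S$ consists of a set $I(a)$ for each $a\in S$ and a subset $C(a,i)\subseteq S$ for each $a\in S$, $i\in I(a)$ (representing the axioms $a\lhd C(a,i)$). The basic cover $\lhd_{I,C}$ generated by it is the least basic cover with $a\lhd C(a,i)$ for all $a\in S,\ i\in I(a)$; it is inductively generated by the rules: $a\in U$ implies $a\lhd U$; and if $i\in I(a)$ and $C(a,i)\lhd U$, then $a\lhd U$. Adding axioms means enlarging the index sets $I(a)$ correspondingly. $(S,\lhd,\circ)$ is a basic cover with operation if $\lhd$ is a basic cover on $S$ and $\circ$ is a binary operation on $\mathcal P(S)$ such that: $U_1\lhd V_1$ and $U_2\lhd V_2$ imply $U_1\circ U_2\lhd V_1\circ V_2$ (stability); $(U\circ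 V)\circ W\lhd U\circ(V\circ W)$; $U\circ V\lhd V\circ U$. Then $\mathcal A U\circ^{\mathcal A}\mathcal A V=\mathcal A(U\circ V)$ is a well-defined operation on $Sat(\mathcal A)$. A convergent cover is a basic cover with operation such that $\circ^{\mathcal A}$ distributes over arbitrary joins $\bigvee^{\mathcal A}$, i.e. $(Sat(\mathcal A),\bigvee^{\mathcal A},\circ^{\mathcal A})$ is a commutative quantale. *)

theory Defs
  imports Main "HOL-Library.FuncSet"
begin

text \<open>
  The underlying set is an explicit carrier \<open>S\<close> (possibly empty).  A relation between elements
  and subsets of \<open>S\<close> is a predicate that holds only of elements and subsets of \<open>S\<close>; an operation
  on subsets of \<open>S\<close> is a function that is only constrained on subsets of \<open>S\<close>.
\<close>

definition set_cover :: "('a \<Rightarrow> 'a set \<Rightarrow> bool) \<Rightarrow> 'a set \<Rightarrow> 'a set \<Rightarrow> bool" where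
  "set_cover cov U V \<longleftrightarrow> (\<forall>b\<in>U. cov b V)"

definition basic_cover :: "'a set \<Rightarrow> ('a \<Rightarrow> 'a set \<Rightarrow> bool) \<Rightarrow> bool" where
  "basic_cover S cov \<longleftrightarrow>
     (\<forall>a U. cov a U \<longrightarrow> a \<in> S \<and> U \<subseteq> S) \<and>
     (\<forall>a U. U \<subseteq> S \<longrightarrow> a \<in> U \<longrightarrow> cov a U) \<and>
     (\<forall>a U V. a \<in> S \<longrightarrow> U \<subseteq> S \<longrightarrow> V \<subseteq> S \<longrightarrow> cov a U \<longrightarrow> set_cover cov U V \<longrightarrow> cov a V)"

definition saturation :: "'a set \<Rightarrow> ('a \<Rightarrow> 'a set \<Rightarrow> bool) \<Rightarrow> 'a set \<Rightarrow> 'a set" where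
  "saturation S cov U = {a \<in> S. cov a U}"

definition Sat :: "'a set \<Rightarrow> ('a \<Rightarrow> 'a set \<Rightarrow> bool) \<Rightarrow> 'a set set" where
  "Sat S cov = {U. U \<subseteq> S \<and> U = saturation S cov U}"

definition Sat_join :: "'a set \<Rightarrow> ('a \<Rightarrow> 'a set \<Rightarrow> bool) \<Rightarrow> 'a set set \<Rightarrow> 'a set" where
  "Sat_join S cov X = saturation S cov (\<Union>X)"

text \<open>
  The induced operation is given on saturated subsets, each being the saturation of itself;
  \<open>Sat_op_saturation\<close> below is its description on arbitrary representatives.
\<close>

definition Sat_op ::
  "'a set \<Rightarrow> ('a \<Rightarrow> 'a set \<Rightarrow> bool) \<Rightarrow> ('a set \<Rightarrow> 'a set \<Rightarrow> 'a set) \<Rightarrow> 'a set \<Rightarrow> 'a set \<Rightarrow> 'a set" where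
  "Sat_op S cov opn P Q = saturation S cov (opn P Q)"

definition basic_cover_with_operation ::
  "'a set \<Rightarrow> ('a \<Rightarrow> 'a set \<Rightarrow> bool) \<Rightarrow> ('a set \<Rightarrow> 'a set \<Rightarrow> 'a set) \<Rightarrow> bool" where
  "basic_cover_with_operation S cov opn \<longleftrightarrow>
     basic_cover S cov \<and>
     (\<forall>U V. U \<subseteq> S \<longrightarrow> V \<subseteq> S \<longrightarrow> opn U V \<subseteq> S) \<and>
     (\<forall>U1 U2 V1 V2. U1 \<subseteq> S \<longrightarrow> U2 \<subseteq> S \<longrightarrow> V1 \<subseteq> S \<longrightarrow> V2 \<subseteq> S \<longrightarrow>
        set_cover cov U1 V1 \<longrightarrow> set_cover cov U2 V2 \<longrightarrow> set_cover cov (opn U1 U2) (opn V1 V2)) \<and>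
     (\<forall>U V W. U \<subseteq> S \<longrightarrow> V \<subseteq> S \<longrightarrow> W \<subseteq> S \<longrightarrow>
        set_cover cov (opn (opn U V) W) (opn U (opn V W))) \<and>
     (\<forall>U V. U \<subseteq> S \<longrightarrow> V \<subseteq> S \<longrightarrow> set_cover cov (opn U V) (opn V U))"

definition convergent_cover ::
  "'a set \<Rightarrow> ('a \<Rightarrow> 'a set \<Rightarrow> bool) \<Rightarrow> ('a set \<Rightarrow> 'a set \<Rightarrow> 'a set) \<Rightarrow> bool" where
  "convergent_cover S cov opn \<longleftrightarrow>
     basic_cover_with_operation S cov opn \<and>
     (\<forall>P X. P \<in> Sat S cov \<longrightarrow> X \<subseteq> Sat S cov \<longrightarrow>
        Sat_op S cov opn P (Sat_join S cov X) = Sat_join S cov (Sat_op S cov opn P ` X) \<and>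
        Sat_op S cov opn (Sat_join S cov X) P = Sat_join S cov ((\<lambda>Q. Sat_op S cov opn Q P) ` X))"

definition axiom_set :: "'a set \<Rightarrow> ('a \<Rightarrow> 'i set) \<Rightarrow> ('a \<Rightarrow> 'i \<Rightarrow> 'a set) \<Rightarrow> bool" where
  "axiom_set S I C \<longleftrightarrow> (\<forall>a\<in>S. \<forall>i\<in>I a. C a i \<subseteq> S)"

inductive generated_cover ::
  "'a set \<Rightarrow> ('a \<Rightarrow> 'i set) \<Rightarrow> ('a \<Rightarrow> 'i \<Rightarrow> 'a set) \<Rightarrow> 'a \<Rightarrow> 'a set \<Rightarrow> bool"
  for S I C where
  reflexivity: "U \<subseteq> S \<Longrightarrow> a \<in> U \<Longrightarrow> generated_cover S I C a U"
| infinity: "a \<in> S \<Longrightarrow> U \<subseteq> S \<Longrightarrow> i \<in> I a \<Longrightarrow> (\<And>b. b \<in> C a i \<Longrightarrow> generated_cover S I C b U) \<Longrightarrow>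
    generated_cover S I C a U"

definition lift_op :: "('a \<times> 'a \<Rightarrow> 'a set) \<Rightarrow> 'a set \<Rightarrow> 'a set \<Rightarrow> 'a set" where
  "lift_op \<delta> U V = \<Union>{\<delta> (a, b) | a b. a \<in> U \<and> b \<in> V}"

text \<open>
  In the enlarged index sets below, each constructor records the parameters of one family of
  added axioms; the first constructor injects the previous indices.
\<close>

datatype ('a, 'i) J_index = J_old 'i | J_comm 'a 'a | J_assoc 'a 'a 'a

definition J_set ::
  "'a set \<Rightarrow> ('a \<Rightarrow> 'i set) \<Rightarrow> ('a \<times> 'a \<Rightarrow> 'a set) \<Rightarrow> 'a \<Rightarrow> ('a, 'i) J_index set" where
  "J_set S I \<delta> a =
     J_old ` I a \<union>
     {J_comm b c | b c. b \<in> S \<and> c \<in> S \<and> a \<in> lift_op \<delta> {b} {c}} \<union>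
     {J_assoc b c d | b c d. b \<in> S \<and> c \<in> S \<and> d \<in> S \<and>
        a \<in> lift_op \<delta> (lift_op \<delta> {b} {c}) {d}}"

fun D_set ::
  "('a \<Rightarrow> 'i \<Rightarrow> 'a set) \<Rightarrow> ('a \<times> 'a \<Rightarrow> 'a set) \<Rightarrow> 'a \<Rightarrow> ('a, 'i) J_index \<Rightarrow> 'a set" where
  "D_set C \<delta> a (J_old i) = C a i"
| "D_set C \<delta> a (J_comm b c) = lift_op \<delta> {c} {b}"
| "D_set C \<delta> a (J_assoc b c d) = lift_op \<delta> {b} (lift_op \<delta> {c} {d})"

datatype ('a, 'j) J'_index = J'_old 'j | J'_local 'a 'j 'a

definition J'_set ::
  "'a set \<Rightarrow> ('a \<Rightarrow> 'i set) \<Rightarrow> ('a \<times> 'a \<Rightarrow> 'a set) \<Rightarrow> 'a \<Rightarrow> ('a, ('a, 'i) J_index) J'_index set" where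
  "J'_set S I \<delta> a =
     J'_old ` J_set S I \<delta> a \<union>
     {J'_local b j c | b j c. b \<in> S \<and> c \<in> S \<and> j \<in> J_set S I \<delta> b \<and> a \<in> lift_op \<delta> {b} {c}}"

fun D'_set ::
  "('a \<Rightarrow> 'i \<Rightarrow> 'a set) \<Rightarrow> ('a \<times> 'a \<Rightarrow> 'a set) \<Rightarrow> 'a \<Rightarrow> ('a, ('a, 'i) J_index) J'_index \<Rightarrow> 'a set" where
  "D'_set C \<delta> a (J'_old j) = D_set C \<delta> a j"
| "D'_set C \<delta> a (J'_local b j c) = lift_op \<delta> (D_set C \<delta> b j) {c}"

definition contains_cover ::
  "'a set \<Rightarrow> ('a \<Rightarrow> 'a set \<Rightarrow> bool) \<Rightarrow> ('a \<Rightarrow> 'a set \<Rightarrow> bool) \<Rightarrow> bool" where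
  "contains_cover S cov cov0 \<longleftrightarrow> (\<forall>a U. a \<in> S \<longrightarrow> U \<subseteq> S \<longrightarrow> cov0 a U \<longrightarrow> cov a U)"

definition op_extends ::
  "'a set \<Rightarrow> ('a \<Rightarrow> 'a set \<Rightarrow> bool) \<Rightarrow> ('a set \<Rightarrow> 'a set \<Rightarrow> 'a set) \<Rightarrow> ('a \<times> 'a \<Rightarrow> 'a set) \<Rightarrow> bool" where
  "op_extends S cov opn \<delta> \<longleftrightarrow>
     (\<forall>a\<in>S. \<forall>b\<in>S. saturation S cov (opn {a} {b}) = saturation S cov (\<delta> (a, b)))"

lemma Sat_op_saturation:
  assumes "basic_cover_with_operation S cov opn" and "U \<subseteq> S" and "V \<subseteq> S"
  shows "Sat_op S cov opn (saturation S cov U) (saturation S cov V) = saturation S cov (opn U V)"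
proof -
  let ?A = "saturation S cov"
  have bc: "basic_cover S cov" and cl: "\<And>U V. U \<subseteq> S \<Longrightarrow> V \<subseteq> S \<Longrightarrow> opn U V \<subseteq> S"
    and st: "\<And>U1 U2 V1 V2. U1 \<subseteq> S \<Longrightarrow> U2 \<subseteq> S \<Longrightarrow> V1 \<subseteq> S \<Longrightarrow> V2 \<subseteq> S \<Longrightarrow>
        set_cover cov U1 V1 \<Longrightarrow> set_cover cov U2 V2 \<Longrightarrow> set_cover cov (opn U1 U2) (opn V1 V2)"
    using assms(1) unfolding basic_cover_with_operation_def by simp_all
  have tr: "\<And>a U V. a \<in> S \<Longrightarrow> U \<subseteq> S \<Longrightarrow> V \<subseteq> S \<Longrightarrow> cov a U \<Longrightarrow> set_cover cov U V \<Longrightarrow> cov a V"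
    and rf: "\<And>a U. U \<subseteq> S \<Longrightarrow> a \<in> U \<Longrightarrow> cov a U"
    using bc unfolding basic_cover_def by metis+
  have sub: "?A U \<subseteq> S" "?A V \<subseteq> S" by (auto simp: saturation_def)
  have c1: "set_cover cov (?A U) U" "set_cover cov (?A V) V"
    by (auto simp: saturation_def set_cover_def)
  have c2: "set_cover cov U (?A U)" "set_cover cov V (?A V)"
    using assms(2,3) sub rf by (auto simp: saturation_def set_cover_def subset_iff)
  have "set_cover cov (opn (?A U) (?A V)) (opn U V)" "set_cover cov (opn U V) (opn (?A U) (?A V))"
    using st[OF sub assms(2,3) c1] st[OF assms(2,3) sub c2] .
  then show ?thesis
    using tr[OF _ cl[OF sub] cl[OF assms(2,3)]] tr[OF _ cl[OF assms(2,3)] cl[OF sub]]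
    unfolding Sat_op_def by (auto simp: saturation_def)
qed

lemma generated_cover_least:
  assumes "axiom_set S I C"
  shows "basic_cover S (generated_cover S I C)"
    and "\<And>a i. a \<in> S \<Longrightarrow> i \<in> I a \<Longrightarrow> generated_cover S I C a (C a i)"
    and "\<And>cov a U. basic_cover S cov \<Longrightarrow> (\<And>a i. a \<in> S \<Longrightarrow> i \<in> I a \<Longrightarrow> cov a (C a i)) \<Longrightarrow>
      generated_cover S I C a U \<Longrightarrow> cov a U"
proof -
  have dom: "a \<in> S \<and> U \<subseteq> S" if "generated_cover S I C a U" for a U
    using that by cases auto
  have tr: "generated_cover S I C a V"
    if "generated_cover S I C a U" "set_cover (generated_cover S I C) U V" "V \<subseteq> S" for a U V
    using that
  proof induction
    case (reflexivity U a)
    then show ?case by (simp add: set_cover_def)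
  next
    case (infinity a U i)
    show ?case
      by (rule generated_cover.infinity[where a = a and I = I and C = C and i = i, OF infinity.hyps(1) \<open>V \<subseteq> S\<close> infinity.hyps(3)])
        (rule infinity.IH[OF _ infinity.prems])
  qed
  show "basic_cover S (generated_cover S I C)"
    unfolding basic_cover_def
  proof (intro conjI allI impI)
    show "a \<in> S" "U \<subseteq> S" if "generated_cover S I C a U" for a U using dom that by blast+
    show "generated_cover S I C a U" if "U \<subseteq> S" "a \<in> U" for a U
      using that by (rule generated_cover.reflexivity)
    show "generated_cover S I C a V"
      if "V \<subseteq> S" "generated_cover S I C a U" "set_cover (generated_cover S I C) U V" for a U V
      using that(2,3,1) by (rule tr)
  qed
  show "generated_cover S I C a (C a i)" if "a \<in> S" "i \<in> I a" for a i
  proof -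
    have "C a i \<subseteq> S" using that assms by (simp add: axiom_set_def)
    then show ?thesis
      by (rule generated_cover.infinity[where a = a and I = I and C = C and i = i, OF that(1) _ that(2)])
        (rule generated_cover.reflexivity[OF \<open>C a i \<subseteq> S\<close>])
  qed
  show "cov a U" if bc: "basic_cover S cov" and ax: "\<And>a i. a \<in> S \<Longrightarrow> i \<in> I a \<Longrightarrow> cov a (C a i)"
    and "generated_cover S I C a U" for cov a U
    using that(3)
  proof induction
    case (reflexivity U a)
    then show ?case using bc unfolding basic_cover_def by metis
  next
    case (infinity a U i)
    have "C a i \<subseteq> S" using assms infinity.hyps by (auto simp: axiom_set_def)
    moreover have "set_cover cov (C a i) U" using infinity.IH by (auto simp: set_cover_def)
    ultimately show ?case
      using bc ax[OF infinity.hyps(1,3)] infinity.hyps(1,2) unfolding basic_cover_def by metis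
  qed
qed

end

theory Submission
  imports Defs
begin

text \<open>
  The operation \<open>lift_op \<delta>\<close> commutes with unions in each argument, so once it respects the cover,
  distributivity over the joins of \<open>Sat\<close> is automatic.  Its commutativity and associativity are
  among the axioms, and stability reduces to \<^emph>\<open>localization\<close>: if \<open>a\<close> is covered by \<open>U\<close>, then
  \<open>a \<circ> c\<close> is covered by \<open>U \<circ> c\<close>.  This is proved by induction on the cover
  (\<open>localization\<close>).  The localization of an axiom of \<open>J\<close> is again an axiom, by the very
  choice of \<open>J'\<close>.  A localized axiom of \<open>J'\<close> can be localized once more because of associativity: for
  \<open>a \<in> b \<circ> d\<close>, localizing \<open>a \<lhd> D(b,j) \<circ> d\<close> at \<open>c\<close> amounts to localizing \<open>b \<lhd> D(b,j)\<close> at the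
  elements of \<open>d \<circ> c\<close>.  Only the direction
  \<open>(b \<circ> c) \<circ> d \<lhd> b \<circ> (c \<circ> d)\<close> of associativity is an axiom; the converse is derived in
  \<open>assoc_converse\<close> from commutativity and from localized commutativity, the latter being one of the
  axioms of \<open>J'\<close>.

  For minimality, distributivity forces the operation of a convergent cover to be determined, up to
  equality of saturations, by its values on singletons (\<open>op_determined_by_singletons\<close>).  Hence an
  operation extending \<open>\<delta>\<close> agrees with \<open>lift_op \<delta>\<close> in this sense, so \<open>lift_op \<delta>\<close> inherits stability,
  associativity and commutativity; these make every axiom of \<open>J'\<close> valid in the given cover.
\<close>

section \<open>Covers and saturations\<close>

lemma basic_cover_carrier:
  assumes "basic_cover S cov" and "cov a U"
  shows "a \<in> S" and "U \<subseteq> S"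
proof -
  have "\<forall>a U. cov a U \<longrightarrow> a \<in> S \<and> U \<subseteq> S"
    using assms(1) unfolding basic_cover_def by (rule conjunct1)
  with assms(2) show "a \<in> S" and "U \<subseteq> S" by blast+
qed

lemma set_cover_subset:
  assumes "basic_cover S cov" and "U \<subseteq> V" and "V \<subseteq> S"
  shows "set_cover cov U V"
proof -
  have "\<forall>a U. U \<subseteq> S \<longrightarrow> a \<in> U \<longrightarrow> cov a U"
    using assms(1) unfolding basic_cover_def by (elim conjE)
  with assms(2,3) show ?thesis unfolding set_cover_def by blast
qed

lemma cover_trans:
  assumes "basic_cover S cov" and "W \<subseteq> S" and "cov a V" and "set_cover cov V W"
  shows "cov a W"
proof -
  have "\<forall>a U V. a \<in> S \<longrightarrow> U \<subseteq> S \<longrightarrow> V \<subseteq> S \<longrightarrow> cov a U \<longrightarrow> set_cover cov U V \<longrightarrow> cov a V"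
    using assms(1) unfolding basic_cover_def by (elim conjE)
  with assms(2-) basic_cover_carrier[OF assms(1,3)] show ?thesis by blast
qed

lemma set_cover_trans:
  assumes "basic_cover S cov" and "W \<subseteq> S" and "set_cover cov U V" and "set_cover cov V W"
  shows "set_cover cov U W"
  using cover_trans[OF assms(1,2) _ assms(4)] assms(3) unfolding set_cover_def by blast

lemma set_cover_Union_iff: "set_cover cov (\<Union>F) V \<longleftrightarrow> (\<forall>U\<in>F. set_cover cov U V)"
  unfolding set_cover_def by blast

lemma saturation_subset: "saturation S cov U \<subseteq> S"
  unfolding saturation_def by blast

lemma subset_saturation:
  assumes "basic_cover S cov" and "U \<subseteq> S"
  shows "U \<subseteq> saturation S cov U"
  using set_cover_subset[OF assms(1) subset_refl assms(2)] assms(2)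
  unfolding set_cover_def saturation_def by blast

lemma saturation_eq_iff:
  assumes "basic_cover S cov" and "U \<subseteq> S" and "V \<subseteq> S"
  shows "saturation S cov U = saturation S cov V \<longleftrightarrow> set_cover cov U V \<and> set_cover cov V U"
proof
  assume "saturation S cov U = saturation S cov V"
  moreover have "U \<subseteq> saturation S cov U" "V \<subseteq> saturation S cov V"
    using subset_saturation[OF assms(1)] assms(2,3) by blast+
  ultimately show "set_cover cov U V \<and> set_cover cov V U"
    unfolding set_cover_def saturation_def by blast
next
  assume "set_cover cov U V \<and> set_cover cov V U"
  then show "saturation S cov U = saturation S cov V"
    using cover_trans[OF assms(1)] assms(2,3) unfolding saturation_def by blast
qed

lemma saturation_idem:
  assumes "basic_cover S cov" and "U \<subseteq> S"
  shows "saturation S cov (saturation S cov U) = saturation S cov U"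
proof -
  have "set_cover cov (saturation S cov U) U"
    unfolding set_cover_def saturation_def by blast
  moreover have "set_cover cov U (saturation S cov U)"
    by (rule set_cover_subset[OF assms(1) subset_saturation[OF assms] saturation_subset])
  ultimately show ?thesis
    using saturation_eq_iff[OF assms(1) saturation_subset assms(2)] by blast
qed

lemma saturation_in_Sat:
  assumes "basic_cover S cov" and "U \<subseteq> S"
  shows "saturation S cov U \<in> Sat S cov"
  using saturation_idem[OF assms] by (simp add: Sat_def saturation_subset)

text \<open>
  Saturation is a closure operator, so members of a union may be replaced by equally saturated ones.
\<close>

lemma saturation_UN_cong:
  assumes bc: "basic_cover S cov"
    and sub: "\<And>x. x \<in> A \<Longrightarrow> f x \<subseteq> S" "\<And>x. x \<in> A \<Longrightarrow> g x \<subseteq> S"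
    and eq: "\<And>x. x \<in> A \<Longrightarrow> saturation S cov (f x) = saturation S cov (g x)"
  shows "saturation S cov (\<Union>x\<in>A. f x) = saturation S cov (\<Union>x\<in>A. g x)"
proof -
  have le: "set_cover cov (\<Union>x\<in>A. f' x) (\<Union>x\<in>A. g' x)"
    if "\<And>x. x \<in> A \<Longrightarrow> set_cover cov (f' x) (g' x)" "\<And>x. x \<in> A \<Longrightarrow> g' x \<subseteq> S" for f' g'
  proof -
    have "set_cover cov (f' x) (\<Union>x\<in>A. g' x)" if "x \<in> A" for x
    proof (rule set_cover_trans[OF bc])
      show "(\<Union>x\<in>A. g' x) \<subseteq> S" using \<open>\<And>x. x \<in> A \<Longrightarrow> g' x \<subseteq> S\<close> by blast
      then show "set_cover cov (g' x) (\<Union>x\<in>A. g' x)"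
        using that by (intro set_cover_subset[OF bc]) auto
    qed (use \<open>\<And>x. x \<in> A \<Longrightarrow> set_cover cov (f' x) (g' x)\<close> that in blast)
    then show ?thesis unfolding set_cover_Union_iff by blast
  qed
  have "set_cover cov (f x) (g x) \<and> set_cover cov (g x) (f x)" if "x \<in> A" for x
    using eq[OF that] saturation_eq_iff[OF bc sub(1)[OF that] sub(2)[OF that]] by blast
  then have "set_cover cov (\<Union>x\<in>A. f x) (\<Union>x\<in>A. g x)" "set_cover cov (\<Union>x\<in>A. g x) (\<Union>x\<in>A. f x)"
    using le[of f g] le[of g f] sub by simp_all
  moreover have "(\<Union>x\<in>A. f x) \<subseteq> S" "(\<Union>x\<in>A. g x) \<subseteq> S" using sub by blast+
  ultimately show ?thesis using saturation_eq_iff[OF bc] by blast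
qed

lemma Sat_join_saturations:
  assumes "basic_cover S cov" and "\<And>x. x \<in> A \<Longrightarrow> f x \<subseteq> S"
  shows "Sat_join S cov ((\<lambda>x. saturation S cov (f x)) ` A) = saturation S cov (\<Union>x\<in>A. f x)"
  unfolding Sat_join_def
  by (rule saturation_UN_cong[OF assms(1) saturation_subset assms(2)])
    (use saturation_idem[OF assms(1)] assms(2) in auto)

section \<open>Operations on a basic cover\<close>

lemma basic_cover_with_operationD:
  assumes "basic_cover_with_operation S cov opn"
  shows "basic_cover S cov"
    and "\<And>U V. U \<subseteq> S \<Longrightarrow> V \<subseteq> S \<Longrightarrow> opn U V \<subseteq> S"
    and "\<And>U1 U2 V1 V2. U1 \<subseteq> S \<Longrightarrow> U2 \<subseteq> S \<Longrightarrow> V1 \<subseteq> S \<Longrightarrow> V2 \<subseteq> S \<Longrightarrow>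
        set_cover cov U1 V1 \<Longrightarrow> set_cover cov U2 V2 \<Longrightarrow> set_cover cov (opn U1 U2) (opn V1 V2)"
    and "\<And>U V W. U \<subseteq> S \<Longrightarrow> V \<subseteq> S \<Longrightarrow> W \<subseteq> S \<Longrightarrow>
        set_cover cov (opn (opn U V) W) (opn U (opn V W))"
    and "\<And>U V. U \<subseteq> S \<Longrightarrow> V \<subseteq> S \<Longrightarrow> set_cover cov (opn U V) (opn V U)"
  using assms unfolding basic_cover_with_operation_def by simp_all

text \<open>
  The conditions on an operation depend only on the saturations of its values; this carries them
  over from an operation extending \<open>\<delta>\<close> to \<open>lift_op \<delta>\<close>.
\<close>

lemma basic_cover_with_operation_cong:
  assumes op: "basic_cover_with_operation S cov opn"
    and cl: "\<And>U V. U \<subseteq> S \<Longrightarrow> V \<subseteq> S \<Longrightarrow> opn' U V \<subseteq> S"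
    and eq: "\<And>U V. U \<subseteq> S \<Longrightarrow> V \<subseteq> S \<Longrightarrow> saturation S cov (opn U V) = saturation S cov (opn' U V)"
  shows "basic_cover_with_operation S cov opn'"
proof -
  note [simp] = basic_cover_with_operationD(2)[OF op] cl
  note bc = basic_cover_with_operationD(1)[OF op]
    and st = basic_cover_with_operationD(3)[OF op]
    and as = basic_cover_with_operationD(4)[OF op]
    and cm = basic_cover_with_operationD(5)[OF op]
  have to: "set_cover cov (opn U V) (opn' U V)" and of': "set_cover cov (opn' U V) (opn U V)"
    if "U \<subseteq> S" "V \<subseteq> S" for U V
    using eq[OF that] saturation_eq_iff[OF bc] that by simp_all
  have rf: "set_cover cov U U" if "U \<subseteq> S" for U
    using set_cover_subset[OF bc subset_refl that] .
  note tr = set_cover_trans[OF bc]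
  have conj: "set_cover cov (opn' U V) (opn' U' V')"
    if "U \<subseteq> S" "V \<subseteq> S" "U' \<subseteq> S" "V' \<subseteq> S" "set_cover cov (opn U V) (opn U' V')" for U V U' V'
    using that by (intro tr[OF _ of' tr[OF _ _ to]]) auto
  show ?thesis
    unfolding basic_cover_with_operation_def
  proof (intro conjI allI impI)
    show "basic_cover S cov" by (rule bc)
  next
    fix U V assume "U \<subseteq> S" "V \<subseteq> S"
    then show "opn' U V \<subseteq> S" by simp
  next
    fix U1 U2 V1 V2
    assume "U1 \<subseteq> S" "U2 \<subseteq> S" "V1 \<subseteq> S" "V2 \<subseteq> S" "set_cover cov U1 V1" "set_cover cov U2 V2"
    then show "set_cover cov (opn' U1 U2) (opn' V1 V2)" by (intro conj st)
  next
    fix U V W assume sub: "U \<subseteq> S" "V \<subseteq> S" "W \<subseteq> S"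
    have "set_cover cov (opn (opn' U V) W) (opn (opn U V) W)"
      using sub by (intro st of' rf) auto
    moreover have "set_cover cov (opn U (opn V W)) (opn U (opn' V W))"
      using sub by (intro st to rf) auto
    ultimately have "set_cover cov (opn (opn' U V) W) (opn U (opn' V W))"
      using sub tr[OF _ tr[OF _ _ as]] by (meson basic_cover_with_operationD(2)[OF op] cl)
    then show "set_cover cov (opn' (opn' U V) W) (opn' U (opn' V W))"
      using sub by (intro conj) auto
  next
    fix U V assume "U \<subseteq> S" "V \<subseteq> S"
    then show "set_cover cov (opn' U V) (opn' V U)" by (intro conj cm)
  qed
qed

text \<open>
  Distributivity over joins of saturated sets, read on arbitrary representatives: up to saturation,
  the operation of a convergent cover preserves unions in each argument.
\<close>

lemma convergent_op_UN:
  assumes conv: "convergent_cover S cov opn"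
    and P: "P \<subseteq> S" and f: "\<And>x. x \<in> A \<Longrightarrow> f x \<subseteq> S"
  shows "saturation S cov (opn P (\<Union>x\<in>A. f x)) = saturation S cov (\<Union>x\<in>A. opn P (f x))"
    and "saturation S cov (opn (\<Union>x\<in>A. f x) P) = saturation S cov (\<Union>x\<in>A. opn (f x) P)"
proof -
  have op: "basic_cover_with_operation S cov opn"
    using conv unfolding convergent_cover_def by blast
  note bc = basic_cover_with_operationD(1)[OF op] and cl = basic_cover_with_operationD(2)[OF op]
  let ?A = "saturation S cov"
  let ?X = "(\<lambda>x. ?A (f x)) ` A"
  have UN: "(\<Union>x\<in>A. f x) \<subseteq> S" using f by blast
  have mem: "?A P \<in> Sat S cov" "?X \<subseteq> Sat S cov"
    using saturation_in_Sat[OF bc] P f by auto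
  have dist: "Sat_op S cov opn (?A P) (Sat_join S cov ?X) = Sat_join S cov (Sat_op S cov opn (?A P) ` ?X)"
    "Sat_op S cov opn (Sat_join S cov ?X) (?A P) = Sat_join S cov ((\<lambda>Q. Sat_op S cov opn Q (?A P)) ` ?X)"
    using conv mem unfolding convergent_cover_def by blast+
  have join: "Sat_join S cov ?X = ?A (\<Union>x\<in>A. f x)"
    by (rule Sat_join_saturations[OF bc f])
  have "Sat_op S cov opn (?A P) ` ?X = (\<lambda>x. ?A (opn P (f x))) ` A"
    "(\<lambda>Q. Sat_op S cov opn Q (?A P)) ` ?X = (\<lambda>x. ?A (opn (f x) P)) ` A"
    unfolding image_image using Sat_op_saturation[OF op] P f by (auto intro!: image_cong)
  then show "?A (opn P (\<Union>x\<in>A. f x)) = ?A (\<Union>x\<in>A. opn P (f x))"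
    "?A (opn (\<Union>x\<in>A. f x) P) = ?A (\<Union>x\<in>A. opn (f x) P)"
    using dist join Sat_op_saturation[OF op P UN] Sat_op_saturation[OF op UN P]
      Sat_join_saturations[OF bc, of A "\<lambda>x. opn P (f x)"]
      Sat_join_saturations[OF bc, of A "\<lambda>x. opn (f x) P"] cl P f by auto
qed

text \<open>Every subset is the union of its singletons, and unions can be pulled out of both arguments.\<close>

lemma op_determined_by_singletons:
  assumes conv: "convergent_cover S cov opn" and U: "U \<subseteq> S" and V: "V \<subseteq> S"
  shows "saturation S cov (opn U V) = saturation S cov (\<Union>a\<in>U. \<Union>b\<in>V. opn {a} {b})"
proof -
  have op: "basic_cover_with_operation S cov opn"
    using conv unfolding convergent_cover_def by blast
  note bc = basic_cover_with_operationD(1)[OF op] and cl = basic_cover_with_operationD(2)[OF op]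
  have "saturation S cov (opn U V) = saturation S cov (\<Union>a\<in>U. opn {a} V)"
    using convergent_op_UN(2)[OF conv V, of U "\<lambda>a. {a}"] U by auto
  also have "\<dots> = saturation S cov (\<Union>a\<in>U. \<Union>b\<in>V. opn {a} {b})"
  proof (rule saturation_UN_cong[OF bc])
    fix a assume "a \<in> U"
    then have a: "{a} \<subseteq> S" using U by blast
    then show "opn {a} V \<subseteq> S" "(\<Union>b\<in>V. opn {a} {b}) \<subseteq> S"
      using V cl by (auto dest!: subsetD[OF cl, rotated 2])
    show "saturation S cov (opn {a} V) = saturation S cov (\<Union>b\<in>V. opn {a} {b})"
      using convergent_op_UN(1)[OF conv a, of V "\<lambda>b. {b}"] V by auto
  qed
  finally show ?thesis .
qed

section \<open>The operation given by a map on pairs\<close>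

lemma lift_op_eq_UN: "lift_op \<delta> U V = (\<Union>a\<in>U. \<Union>b\<in>V. \<delta> (a, b))"
  unfolding lift_op_def by blast

lemma lift_op_singletons: "lift_op \<delta> {a} {b} = \<delta> (a, b)"
  unfolding lift_op_eq_UN by simp

lemma lift_op_mono: "U \<subseteq> U' \<Longrightarrow> V \<subseteq> V' \<Longrightarrow> lift_op \<delta> U V \<subseteq> lift_op \<delta> U' V'"
  unfolding lift_op_eq_UN by blast

lemma lift_op_subset:
  assumes "\<delta> \<in> S \<times> S \<rightarrow> Pow S" and "U \<subseteq> S" and "V \<subseteq> S"
  shows "lift_op \<delta> U V \<subseteq> S"
  using assms unfolding lift_op_eq_UN by blast

lemma op_extends_lift_op: "op_extends S cov (lift_op \<delta>) \<delta>"
  unfolding op_extends_def lift_op_singletons by blast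

lemma convergent_lift_op:
  assumes op: "basic_cover_with_operation S cov (lift_op \<delta>)"
  shows "convergent_cover S cov (lift_op \<delta>)"
  unfolding convergent_cover_def
proof (intro conjI allI impI)
  note bc = basic_cover_with_operationD(1)[OF op] and cl = basic_cover_with_operationD(2)[OF op]
  fix P X assume "P \<in> Sat S cov" "X \<subseteq> Sat S cov"
  then have P: "P \<subseteq> S" "saturation S cov P = P" and X: "\<And>Q. Q \<in> X \<Longrightarrow> Q \<subseteq> S" "\<Union>X \<subseteq> S"
    unfolding Sat_def by auto
  have "Sat_op S cov (lift_op \<delta>) P (Sat_join S cov X) = saturation S cov (lift_op \<delta> P (\<Union>X))"
    using Sat_op_saturation[OF op P(1) X(2)] P(2) unfolding Sat_join_def by simp
  also have "lift_op \<delta> P (\<Union>X) = (\<Union>Q\<in>X. lift_op \<delta> P Q)"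
    unfolding lift_op_eq_UN by blast
  also have "saturation S cov \<dots> = Sat_join S cov (Sat_op S cov (lift_op \<delta>) P ` X)"
    using Sat_join_saturations[OF bc, of X "lift_op \<delta> P"] cl P(1) X(1) unfolding Sat_op_def by simp
  finally show "Sat_op S cov (lift_op \<delta>) P (Sat_join S cov X) =
      Sat_join S cov (Sat_op S cov (lift_op \<delta>) P ` X)" .
  have "Sat_op S cov (lift_op \<delta>) (Sat_join S cov X) P = saturation S cov (lift_op \<delta> (\<Union>X) P)"
    using Sat_op_saturation[OF op X(2) P(1)] P(2) unfolding Sat_join_def by simp
  also have "lift_op \<delta> (\<Union>X) P = (\<Union>Q\<in>X. lift_op \<delta> Q P)"
    unfolding lift_op_eq_UN by blast
  also have "saturation S cov \<dots> = Sat_join S cov ((\<lambda>Q. Sat_op S cov (lift_op \<delta>) Q P) ` X)"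
    using Sat_join_saturations[OF bc, of X "\<lambda>Q. lift_op \<delta> Q P"] cl P(1) X(1)
    unfolding Sat_op_def by simp
  finally show "Sat_op S cov (lift_op \<delta>) (Sat_join S cov X) P =
      Sat_join S cov ((\<lambda>Q. Sat_op S cov (lift_op \<delta>) Q P) ` X)" .
qed (rule op)

lemma extension_eq_lift_op:
  assumes conv: "convergent_cover S cov opn" and ext: "op_extends S cov opn \<delta>"
    and \<delta>: "\<delta> \<in> S \<times> S \<rightarrow> Pow S" and U: "U \<subseteq> S" and V: "V \<subseteq> S"
  shows "saturation S cov (opn U V) = saturation S cov (lift_op \<delta> U V)"
proof -
  have op: "basic_cover_with_operation S cov opn"
    using conv unfolding convergent_cover_def by blast
  note bc = basic_cover_with_operationD(1)[OF op] and cl = basic_cover_with_operationD(2)[OF op]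
  have sub: "opn {a} {b} \<subseteq> S" "\<delta> (a, b) \<subseteq> S" if "a \<in> U" "b \<in> V" for a b
    using that U V cl[of "{a}" "{b}"] \<delta> by auto
  have "saturation S cov (opn U V) = saturation S cov (\<Union>a\<in>U. \<Union>b\<in>V. opn {a} {b})"
    by (rule op_determined_by_singletons[OF conv U V])
  also have "\<dots> = saturation S cov (\<Union>a\<in>U. \<Union>b\<in>V. \<delta> (a, b))"
  proof (rule saturation_UN_cong[OF bc])
    fix a assume a: "a \<in> U"
    show "(\<Union>b\<in>V. opn {a} {b}) \<subseteq> S" "(\<Union>b\<in>V. \<delta> (a, b)) \<subseteq> S"
      using sub[OF a] by blast+
    show "saturation S cov (\<Union>b\<in>V. opn {a} {b}) = saturation S cov (\<Union>b\<in>V. \<delta> (a, b))"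
    proof (rule saturation_UN_cong[OF bc])
      fix b assume b: "b \<in> V"
      show "opn {a} {b} \<subseteq> S" "\<delta> (a, b) \<subseteq> S" using sub[OF a b] .
      show "saturation S cov (opn {a} {b}) = saturation S cov (\<delta> (a, b))"
        using ext a b U V unfolding op_extends_def by blast
    qed
  qed
  finally show ?thesis unfolding lift_op_eq_UN .
qed

section \<open>The generated cover\<close>

context
  fixes S :: "'a set" and I :: "'a \<Rightarrow> 'i set" and C :: "'a \<Rightarrow> 'i \<Rightarrow> 'a set"
    and \<delta> :: "'a \<times> 'a \<Rightarrow> 'a set"
  assumes axiom_set_IC: "axiom_set S I C" and \<delta>_closed: "\<delta> \<in> S \<times> S \<rightarrow> Pow S"
begin

abbreviation (input) op_\<delta> (infixl "\<circ>\<delta>" 70) where "op_\<delta> \<equiv> lift_op \<delta>"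

abbreviation (input) gen where "gen \<equiv> generated_cover S (J'_set S I \<delta>) (D'_set C \<delta>)"

lemma axiom_set_JD: "axiom_set S (J_set S I \<delta>) (D_set C \<delta>)"
  unfolding axiom_set_def
proof (intro ballI)
  note cl = lift_op_subset[OF \<delta>_closed]
  fix a j assume a: "a \<in> S" and j: "j \<in> J_set S I \<delta> a"
  show "D_set C \<delta> a j \<subseteq> S"
  proof (cases j)
    case (J_old i)
    then have "i \<in> I a" using j unfolding J_set_def by auto
    then show ?thesis using axiom_set_IC a J_old unfolding axiom_set_def by simp
  next
    case (J_comm b c)
    then show ?thesis using j cl[of "{c}" "{b}"] unfolding J_set_def by auto
  next
    case (J_assoc b c d)
    then have "{b} \<subseteq> S" "{c} \<subseteq> S" "{d} \<subseteq> S" using j unfolding J_set_def by auto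
    then show ?thesis using J_assoc cl by simp
  qed
qed

lemma axiom_set_J'D': "axiom_set S (J'_set S I \<delta>) (D'_set C \<delta>)"
  unfolding axiom_set_def
proof (intro ballI)
  fix a j' assume a: "a \<in> S" and j': "j' \<in> J'_set S I \<delta> a"
  show "D'_set C \<delta> a j' \<subseteq> S"
  proof (cases j')
    case (J'_old j)
    then have "j \<in> J_set S I \<delta> a" using j' unfolding J'_set_def by auto
    then show ?thesis using axiom_set_JD a J'_old unfolding axiom_set_def by simp
  next
    case (J'_local b j c)
    then have "b \<in> S" "j \<in> J_set S I \<delta> b" "{c} \<subseteq> S" using j' unfolding J'_set_def by auto
    then show ?thesis
      using axiom_set_JD J'_local lift_op_subset[OF \<delta>_closed] unfolding axiom_set_def by simp
  qed
qed

lemmas basic_cover_gen = generated_cover_least(1)[OF axiom_set_J'D']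
  and gen_axiom = generated_cover_least(2)[OF axiom_set_J'D']

lemma gen_J: "a \<in> S \<Longrightarrow> j \<in> J_set S I \<delta> a \<Longrightarrow> gen a (D_set C \<delta> a j)"
  using gen_axiom[of a "J'_old j"] unfolding J'_set_def by simp

lemma gen_local:
  assumes "b \<in> S" and "V \<subseteq> S" and "j \<in> J_set S I \<delta> b"
  shows "set_cover gen ({b} \<circ>\<delta> V) (D_set C \<delta> b j \<circ>\<delta> V)"
  unfolding set_cover_def
proof
  fix a assume "a \<in> {b} \<circ>\<delta> V"
  then obtain c where c: "c \<in> V" "a \<in> {b} \<circ>\<delta> {c}" unfolding lift_op_eq_UN by blast
  then have S: "c \<in> S" "a \<in> S"
    using assms lift_op_subset[OF \<delta>_closed, of "{b}" "{c}"] by auto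
  have D: "D_set C \<delta> b j \<subseteq> S" using axiom_set_JD assms unfolding axiom_set_def by blast
  have "gen a (D_set C \<delta> b j \<circ>\<delta> {c})"
    using gen_axiom[of a "J'_local b j c"] S assms c unfolding J'_set_def by simp
  moreover have "set_cover gen (D_set C \<delta> b j \<circ>\<delta> {c}) (D_set C \<delta> b j \<circ>\<delta> V)"
    using D assms(2) c(1) lift_op_subset[OF \<delta>_closed]
    by (intro set_cover_subset[OF basic_cover_gen] lift_op_mono) auto
  ultimately show "gen a (D_set C \<delta> b j \<circ>\<delta> V)"
    by (rule cover_trans[OF basic_cover_gen lift_op_subset[OF \<delta>_closed D assms(2)]])
qed

lemma gen_comm:
  assumes "U \<subseteq> S" and "V \<subseteq> S"
  shows "set_cover gen (U \<circ>\<delta> V) (V \<circ>\<delta> U)"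
  unfolding set_cover_def
proof
  fix a assume "a \<in> U \<circ>\<delta> V"
  then obtain b c where bc: "b \<in> U" "c \<in> V" "a \<in> {b} \<circ>\<delta> {c}" unfolding lift_op_eq_UN by blast
  then have "J_comm b c \<in> J_set S I \<delta> a" using assms unfolding J_set_def by blast
  moreover have "a \<in> S" using bc lift_op_subset[OF \<delta>_closed assms] \<open>a \<in> U \<circ>\<delta> V\<close> by blast
  ultimately have "gen a ({c} \<circ>\<delta> {b})" using gen_J[of a "J_comm b c"] by simp
  moreover have "set_cover gen ({c} \<circ>\<delta> {b}) (V \<circ>\<delta> U)"
    using bc lift_op_subset[OF \<delta>_closed] assms
    by (intro set_cover_subset[OF basic_cover_gen] lift_op_mono) auto
  ultimately show "gen a (V \<circ>\<delta> U)"
    by (rule cover_trans[OF basic_cover_gen lift_op_subset[OF \<delta>_closed assms(2,1)]])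
qed

lemma gen_assoc:
  assumes "U \<subseteq> S" and "V \<subseteq> S" and "W \<subseteq> S"
  shows "set_cover gen ((U \<circ>\<delta> V) \<circ>\<delta> W) (U \<circ>\<delta> (V \<circ>\<delta> W))"
  unfolding set_cover_def
proof
  fix a assume a: "a \<in> (U \<circ>\<delta> V) \<circ>\<delta> W"
  then obtain b c d where bcd: "b \<in> U" "c \<in> V" "d \<in> W" "a \<in> ({b} \<circ>\<delta> {c}) \<circ>\<delta> {d}"
    unfolding lift_op_eq_UN by blast
  note cl = lift_op_subset[OF \<delta>_closed]
  have "J_assoc b c d \<in> J_set S I \<delta> a" using assms bcd unfolding J_set_def by blast
  moreover have "(U \<circ>\<delta> V) \<circ>\<delta> W \<subseteq> S" using assms by (simp add: cl)
  then have "a \<in> S" using a by blast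
  ultimately have "gen a ({b} \<circ>\<delta> ({c} \<circ>\<delta> {d}))" using gen_J[of a "J_assoc b c d"] by simp
  moreover have "set_cover gen ({b} \<circ>\<delta> ({c} \<circ>\<delta> {d})) (U \<circ>\<delta> (V \<circ>\<delta> W))"
    using bcd assms by (intro set_cover_subset[OF basic_cover_gen] lift_op_mono cl) auto
  ultimately show "gen a (U \<circ>\<delta> (V \<circ>\<delta> W))"
    by (rule cover_trans[OF basic_cover_gen cl[OF assms(1) cl[OF assms(2,3)]]])
qed

text \<open>
  The commutativity axioms belong to \<open>J\<close>, so they are localized in \<open>J'\<close>: the order of the inner
  factors may be changed before anything is known about localization in general.
\<close>

lemma gen_comm_local:
  assumes "U \<subseteq> S" and "V \<subseteq> S" and "W \<subseteq> S"
  shows "set_cover gen ((U \<circ>\<delta> V) \<circ>\<delta> W) ((V \<circ>\<delta> U) \<circ>\<delta> W)"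
  unfolding set_cover_def
proof
  fix a assume "a \<in> (U \<circ>\<delta> V) \<circ>\<delta> W"
  then obtain b c e where bce: "b \<in> U" "c \<in> V" "e \<in> {b} \<circ>\<delta> {c}" "a \<in> {e} \<circ>\<delta> W"
    unfolding lift_op_eq_UN by blast
  note cl = lift_op_subset[OF \<delta>_closed]
  have "J_comm b c \<in> J_set S I \<delta> e" using assms bce unfolding J_set_def by blast
  moreover have "e \<in> S" using bce(1-3) assms cl[of "{b}" "{c}"] by blast
  ultimately have "gen a (({c} \<circ>\<delta> {b}) \<circ>\<delta> W)"
    using gen_local[OF _ assms(3), of e "J_comm b c"] bce(4) unfolding set_cover_def by simp
  moreover have "set_cover gen (({c} \<circ>\<delta> {b}) \<circ>\<delta> W) ((V \<circ>\<delta> U) \<circ>\<delta> W)"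
    using bce assms by (intro set_cover_subset[OF basic_cover_gen] lift_op_mono cl) auto
  ultimately show "gen a ((V \<circ>\<delta> U) \<circ>\<delta> W)"
    by (rule cover_trans[OF basic_cover_gen cl[OF cl[OF assms(2,1)] assms(3)]])
qed

text \<open>
  Rotating the three factors turns one direction of associativity into the other:
  \<open>U(VW) \<lhd> (VW)U \<lhd> (WV)U \<lhd> W(VU) \<lhd> (VU)W \<lhd> (UV)W\<close>.  Commutativity is used at the top level
  or inside the left factor only; inside the right factor it is not yet available.
\<close>

lemma assoc_converse:
  assumes "U \<subseteq> S" and "V \<subseteq> S" and "W \<subseteq> S"
  shows "set_cover gen (U \<circ>\<delta> (V \<circ>\<delta> W)) ((U \<circ>\<delta> V) \<circ>\<delta> W)"
proof -
  note cl = lift_op_subset[OF \<delta>_closed]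
  note tr = set_cover_trans[OF basic_cover_gen]
  have "set_cover gen (U \<circ>\<delta> (V \<circ>\<delta> W)) ((V \<circ>\<delta> W) \<circ>\<delta> U)"
    using assms by (intro gen_comm cl)
  then have "set_cover gen (U \<circ>\<delta> (V \<circ>\<delta> W)) ((W \<circ>\<delta> V) \<circ>\<delta> U)"
    using assms by (elim tr[rotated]; intro gen_comm_local cl)
  then have "set_cover gen (U \<circ>\<delta> (V \<circ>\<delta> W)) (W \<circ>\<delta> (V \<circ>\<delta> U))"
    using assms by (elim tr[rotated]; intro gen_assoc cl)
  then have "set_cover gen (U \<circ>\<delta> (V \<circ>\<delta> W)) ((V \<circ>\<delta> U) \<circ>\<delta> W)"
    using assms by (elim tr[rotated]; intro gen_comm cl)
  then show ?thesis
    using assms by (elim tr[rotated]; intro gen_comm_local cl)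
qed

text \<open>
  Induction on the cover.  In the case of a localized axiom, where \<open>a \<in> b \<circ> d\<close>, the chain is
  \<open>a \<circ> W \<subseteq> (b \<circ> d) \<circ> W \<lhd> b \<circ> (d \<circ> W) \<lhd> D(b,j) \<circ> (d \<circ> W) \<lhd> (D(b,j) \<circ> d) \<circ> W\<close>,
  and the induction hypothesis covers the last set by \<open>U \<circ> W\<close>.
\<close>

lemma localization:
  assumes "gen a U" and W: "W \<subseteq> S"
  shows "set_cover gen ({a} \<circ>\<delta> W) (U \<circ>\<delta> W)"
  using assms(1)
proof induction
  note cl = lift_op_subset[OF \<delta>_closed]
  case (reflexivity U a)
  then show ?case
    using W by (intro set_cover_subset[OF basic_cover_gen] lift_op_mono cl) auto
next
  note cl = lift_op_subset[OF \<delta>_closed] and tr = set_cover_trans[OF basic_cover_gen]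
  case (infinity a U i)
  let ?E = "D'_set C \<delta> a i"
  have IH: "set_cover gen (?E \<circ>\<delta> W) (U \<circ>\<delta> W)"
    using infinity.IH unfolding set_cover_def lift_op_eq_UN by blast
  have "set_cover gen ({a} \<circ>\<delta> W) (?E \<circ>\<delta> W)"
  proof (cases i)
    case (J'_old j)
    then show ?thesis
      using infinity.hyps(1,3) gen_local[OF _ W] unfolding J'_set_def by auto
  next
    case (J'_local b j d)
    then have b: "b \<in> S" and d: "d \<in> S" and j: "j \<in> J_set S I \<delta> b" and a: "a \<in> {b} \<circ>\<delta> {d}"
      using infinity.hyps(3) unfolding J'_set_def by auto
    let ?D = "D_set C \<delta> b j"
    have D: "?D \<subseteq> S" using axiom_set_JD b j unfolding axiom_set_def by blast
    have "set_cover gen ({a} \<circ>\<delta> W) (({b} \<circ>\<delta> {d}) \<circ>\<delta> W)"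
      using a b d W by (intro set_cover_subset[OF basic_cover_gen] lift_op_mono cl) auto
    then have "set_cover gen ({a} \<circ>\<delta> W) ({b} \<circ>\<delta> ({d} \<circ>\<delta> W))"
      using b d W by (elim tr[rotated]; intro gen_assoc cl; simp)
    then have "set_cover gen ({a} \<circ>\<delta> W) (?D \<circ>\<delta> ({d} \<circ>\<delta> W))"
      using b d D W j by (elim tr[rotated]; intro gen_local cl; simp)
    then have "set_cover gen ({a} \<circ>\<delta> W) ((?D \<circ>\<delta> {d}) \<circ>\<delta> W)"
      using b d D W by (elim tr[rotated]; intro assoc_converse cl; simp)
    then show ?thesis using J'_local by simp
  qed
  then show ?case
    using IH cl[OF infinity.hyps(2) W] tr by blast
qed

lemma gen_with_operation: "basic_cover_with_operation S gen (lift_op \<delta>)"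
proof -
  note cl = lift_op_subset[OF \<delta>_closed] and tr = set_cover_trans[OF basic_cover_gen]
  have local: "set_cover gen (U \<circ>\<delta> W) (V \<circ>\<delta> W)" if "set_cover gen U V" "W \<subseteq> S" for U V W
    using that localization[of _ V W] unfolding set_cover_def lift_op_eq_UN by blast
  have stable: "set_cover gen (U1 \<circ>\<delta> U2) (V1 \<circ>\<delta> V2)"
    if sub: "U1 \<subseteq> S" "U2 \<subseteq> S" "V1 \<subseteq> S" "V2 \<subseteq> S" and "set_cover gen U1 V1" "set_cover gen U2 V2"
    for U1 U2 V1 V2
  proof -
    have "set_cover gen (U1 \<circ>\<delta> U2) (V1 \<circ>\<delta> U2)" by (rule local[OF that(5,2)])
    then have "set_cover gen (U1 \<circ>\<delta> U2) (U2 \<circ>\<delta> V1)"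
      using sub by (elim tr[rotated]; intro gen_comm cl)
    then have "set_cover gen (U1 \<circ>\<delta> U2) (V2 \<circ>\<delta> V1)"
      using sub that(6) by (elim tr[rotated]; intro local cl)
    then show ?thesis
      using sub by (elim tr[rotated]; intro gen_comm cl)
  qed
  show ?thesis
    unfolding basic_cover_with_operation_def
    using basic_cover_gen cl stable gen_assoc gen_comm by simp
qed

lemma gen_contains: "contains_cover S gen (generated_cover S I C)"
  unfolding contains_cover_def
proof (intro allI impI)
  fix a U assume "generated_cover S I C a U"
  then show "gen a U"
  proof (rule generated_cover_least(3)[OF axiom_set_IC basic_cover_gen, rotated])
    fix a i assume "a \<in> S" "i \<in> I a"
    then show "gen a (C a i)"
      using gen_J[of a "J_old i"] unfolding J_set_def by simp
  qed
qed

text \<open>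
  A basic cover on which \<open>lift_op \<delta>\<close> is stable, associative and commutative validates all the added
  axioms, the localized ones by stability.
\<close>

lemma gen_least:
  assumes op: "basic_cover_with_operation S cov (lift_op \<delta>)"
    and cont: "contains_cover S cov (generated_cover S I C)"
  shows "contains_cover S cov gen"
proof -
  note bc = basic_cover_with_operationD(1)[OF op]
  have J: "cov a (D_set C \<delta> a j)" if "a \<in> S" "j \<in> J_set S I \<delta> a" for a j
  proof (cases j)
    case (J_old i)
    then have "i \<in> I a" using that(2) unfolding J_set_def by auto
    then have "generated_cover S I C a (C a i)"
      using generated_cover_least(2)[OF axiom_set_IC] that(1) by blast
    then show ?thesis
      using cont J_old \<open>i \<in> I a\<close> that(1) axiom_set_IC
      unfolding contains_cover_def axiom_set_def by simp
  next
    case (J_comm b c)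
    then show ?thesis
      using that(2) basic_cover_with_operationD(5)[OF op, of "{b}" "{c}"]
      unfolding J_set_def set_cover_def by auto
  next
    case (J_assoc b c d)
    then show ?thesis
      using that(2) basic_cover_with_operationD(4)[OF op, of "{b}" "{c}" "{d}"]
      unfolding J_set_def set_cover_def by auto
  qed
  have J': "cov a (D'_set C \<delta> a j')" if "a \<in> S" "j' \<in> J'_set S I \<delta> a" for a j'
  proof (cases j')
    case (J'_old j)
    then show ?thesis using that J unfolding J'_set_def by auto
  next
    case (J'_local b j c)
    then have b: "b \<in> S" and c: "c \<in> S" and j: "j \<in> J_set S I \<delta> b" and a: "a \<in> {b} \<circ>\<delta> {c}"
      using that(2) unfolding J'_set_def by auto
    have "D_set C \<delta> b j \<subseteq> S" using axiom_set_JD b j unfolding axiom_set_def by blast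
    moreover have "set_cover cov {b} (D_set C \<delta> b j)"
      using J[OF b j] unfolding set_cover_def by simp
    moreover have "set_cover cov {c} {c}" using c by (intro set_cover_subset[OF bc]) auto
    ultimately have "set_cover cov ({b} \<circ>\<delta> {c}) (D_set C \<delta> b j \<circ>\<delta> {c})"
      using b c by (intro basic_cover_with_operationD(3)[OF op]) auto
    then show ?thesis using a J'_local unfolding set_cover_def by simp
  qed
  show ?thesis
    unfolding contains_cover_def using generated_cover_least(3)[OF axiom_set_J'D' bc J'] by blast
qed

end

theorem proposition4p11:
  fixes S :: "'a set" and I :: "'a \<Rightarrow> 'i set" and C :: "'a \<Rightarrow> 'i \<Rightarrow> 'a set"
    and \<delta> :: "'a \<times> 'a \<Rightarrow> 'a set"
  assumes "axiom_set S I C"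
    and "\<delta> \<in> S \<times> S \<rightarrow> Pow S"
  shows
    "convergent_cover S (generated_cover S (J'_set S I \<delta>) (D'_set C \<delta>)) (lift_op \<delta>) \<and>
     contains_cover S (generated_cover S (J'_set S I \<delta>) (D'_set C \<delta>)) (generated_cover S I C) \<and>
     op_extends S (generated_cover S (J'_set S I \<delta>) (D'_set C \<delta>)) (lift_op \<delta>) \<delta> \<and>
     (\<forall>cov' opn'.
        convergent_cover S cov' opn' \<and>
        contains_cover S cov' (generated_cover S I C) \<and>
        op_extends S cov' opn' \<delta> \<longrightarrow>
          contains_cover S cov' (generated_cover S (J'_set S I \<delta>) (D'_set C \<delta>)) \<and>
          (\<forall>U V. U \<subseteq> S \<longrightarrow> V \<subseteq> S \<longrightarrow>
             saturation S cov' (opn' U V) = saturation S cov' (lift_op \<delta> U V)))"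
proof (intro conjI allI impI; (elim conjE)?)
  show "convergent_cover S (generated_cover S (J'_set S I \<delta>) (D'_set C \<delta>)) (lift_op \<delta>)"
    by (rule convergent_lift_op[OF gen_with_operation[OF assms]])
  show "contains_cover S (generated_cover S (J'_set S I \<delta>) (D'_set C \<delta>)) (generated_cover S I C)"
    by (rule gen_contains[OF assms])
  show "op_extends S (generated_cover S (J'_set S I \<delta>) (D'_set C \<delta>)) (lift_op \<delta>) \<delta>"
    by (rule op_extends_lift_op)
next
  fix cov' opn'
  assume conv: "convergent_cover S cov' opn'"
    and cont: "contains_cover S cov' (generated_cover S I C)"
    and ext: "op_extends S cov' opn' \<delta>"
  show eq: "saturation S cov' (opn' U V) = saturation S cov' (lift_op \<delta> U V)"
    if "U \<subseteq> S" "V \<subseteq> S" for U V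
    by (rule extension_eq_lift_op[OF conv ext assms(2) that])
  have "basic_cover_with_operation S cov' opn'"
    using conv unfolding convergent_cover_def by blast
  then have "basic_cover_with_operation S cov' (lift_op \<delta>)"
    by (rule basic_cover_with_operation_cong[OF _ lift_op_subset[OF assms(2)] eq])
  then show "contains_cover S cov' (generated_cover S (J'_set S I \<delta>) (D'_set C \<delta>))"
    by (rule gen_least[OF assms _ cont])
qed

end
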